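(* For every prime number $p$ there is an equivariant definable set $X$ in $\mathbf{ZFA}(\mathcal{G}_{\mathcal{F}_p})$ such that the vector space $\mathcal{F}_p^X$ does not have a basis (in $\mathbf{ZFA}(\mathcal{G}_{\mathcal{F}_p})$).
   Context: Let $\mathcal{F}_p$ be the field with $p$ elements. Let $V$ and $V^*$ be two disjoint $\aleph_0$-dimensional vector spaces over $\mathcal{F}_p$ and $\Phi:V\times V^*\to\mathcal{F}_p$ a bilinear map satisfying the Space Extension Axiom: for every finite linearly independent sequence $v_1,\dots,v_k$ in $V$ (resp. $V^*$), scalars $r_1,\dots,r_k\in\mathcal{F}_p$, and finite set $W\subseteq V^*$ (resp. $W\subseteq V$), there is $w\notin W$ with $\Phi(v_i,w)=r_i$ (resp. $\Phi(w,v_i)=r_i$) for all $i$. The polar geometry is the structure $\mathcal{G}_{\mathcal{F}_p}=\langle V\cup V^*,B,\Phi,+,(-)r\ (r\in\mathcal{F}_p)\rangle$, where $+$ and scalar multiplication are interpreted separately on $V$ and $V^*$ and the unary predicate $B$ holds exactly on $V$. $\mathbf{ZFA}(\mathcal{G}_{\mathcal{F}_p})$ is the permutation model with atoms $V\cup V^*$ consisting of hereditarily finitely supported sets (supported by finite $A_0$ = fixed by all automorphisms of the structure fixing $A_0$ pointwise). A set is equivariant if fixed by all automorphisms, and an equivariant set is definable if it has finitely many orbits. $\mathcal{F}_p^X$ is the vector space of finitely supported functions $X\to\mathcal{F}_p$, and a basis must be a finitely supported set. *)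

theory Defs
  imports "HOL-Computational_Algebra.Primes" "HOL-Library.Countable_Set"
begin

text \<open>The field F_p is represented by the residues {0..<p} (nat) with arithmetic mod p.
 Atoms live in a type 'a; V and Vs (for V^*) are disjoint subsets of 'a.
 add and smul are the (partial, separately interpreted) operations of the structure,
 zV / zVs the zero vectors, Phi the pairing V x V^* -> F_p.\<close>

definition lincomb :: "'a \<Rightarrow> ('a \<Rightarrow> 'a \<Rightarrow> 'a) \<Rightarrow> ('a \<Rightarrow> nat \<Rightarrow> 'a) \<Rightarrow> 'a list \<Rightarrow> nat list \<Rightarrow> 'a" where
  "lincomb z add smul vs rs = foldr (\<lambda>(v, r) acc. add (smul v r) acc) (zip vs rs) z"

definition fp_vector_space :: "nat \<Rightarrow> 'a set \<Rightarrow> 'a \<Rightarrow> ('a \<Rightarrow> 'a \<Rightarrow> 'a) \<Rightarrow> ('a \<Rightarrow> nat \<Rightarrow> 'a) \<Rightarrow> bool" where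
  "fp_vector_space p C z add smul \<longleftrightarrow>
     z \<in> C \<and>
     (\<forall>u\<in>C. \<forall>v\<in>C. add u v \<in> C) \<and>
     (\<forall>u\<in>C. \<forall>r<p. smul u r \<in> C) \<and>
     (\<forall>u\<in>C. \<forall>v\<in>C. \<forall>w\<in>C. add (add u v) w = add u (add v w)) \<and>
     (\<forall>u\<in>C. \<forall>v\<in>C. add u v = add v u) \<and>
     (\<forall>u\<in>C. add u z = u) \<and>
     (\<forall>u\<in>C. \<exists>v\<in>C. add u v = z) \<and>
     (\<forall>u\<in>C. smul u 1 = u) \<and>
     (\<forall>u\<in>C. \<forall>r<p. \<forall>s<p. smul (smul u r) s = smul u ((r * s) mod p)) \<and>
     (\<forall>u\<in>C. \<forall>r<p. \<forall>s<p. smul u ((r + s) mod p) = add (smul u r) (smul u s)) \<and>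
     (\<forall>u\<in>C. \<forall>v\<in>C. \<forall>r<p. smul (add u v) r = add (smul u r) (smul v r))"

definition lin_indep_list :: "nat \<Rightarrow> 'a set \<Rightarrow> 'a \<Rightarrow> ('a \<Rightarrow> 'a \<Rightarrow> 'a) \<Rightarrow> ('a \<Rightarrow> nat \<Rightarrow> 'a) \<Rightarrow> 'a list \<Rightarrow> bool" where
  "lin_indep_list p C z add smul vs \<longleftrightarrow> set vs \<subseteq> C \<and>
     (\<forall>rs. length rs = length vs \<and> set rs \<subseteq> {..<p} \<and> lincomb z add smul vs rs = z
        \<longrightarrow> (\<forall>r\<in>set rs. r = 0))"

text \<open>The polar geometry axioms: V, V^* disjoint aleph_0-dimensional F_p-spaces
 (over a finite field this means countably infinite), Phi bilinear, and the
 Space Extension Axiom in both directions.\<close>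
definition polar_geometry ::
  "nat \<Rightarrow> 'a set \<Rightarrow> 'a set \<Rightarrow> 'a \<Rightarrow> 'a \<Rightarrow> ('a \<Rightarrow> 'a \<Rightarrow> 'a) \<Rightarrow> ('a \<Rightarrow> nat \<Rightarrow> 'a) \<Rightarrow> ('a \<Rightarrow> 'a \<Rightarrow> nat) \<Rightarrow> bool" where
  "polar_geometry p V Vs zV zVs add smul Phi \<longleftrightarrow>
     V \<inter> Vs = {} \<and>
     fp_vector_space p V zV add smul \<and> fp_vector_space p Vs zVs add smul \<and>
     countable V \<and> infinite V \<and> countable Vs \<and> infinite Vs \<and>
     (\<forall>u\<in>V. \<forall>w\<in>Vs. Phi u w < p) \<and>
     (\<forall>u\<in>V. \<forall>u'\<in>V. \<forall>w\<in>Vs. Phi (add u u') w = (Phi u w + Phi u' w) mod p) \<and>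
     (\<forall>u\<in>V. \<forall>w\<in>Vs. \<forall>w'\<in>Vs. Phi u (add w w') = (Phi u w + Phi u w') mod p) \<and>
     (\<forall>u\<in>V. \<forall>w\<in>Vs. \<forall>r<p. Phi (smul u r) w = (r * Phi u w) mod p) \<and>
     (\<forall>u\<in>V. \<forall>w\<in>Vs. \<forall>r<p. Phi u (smul w r) = (r * Phi u w) mod p) \<and>
     (\<forall>vs rs W. lin_indep_list p V zV add smul vs \<and> length rs = length vs \<and>
        set rs \<subseteq> {..<p} \<and> finite W \<and> W \<subseteq> Vs \<longrightarrow>
        (\<exists>w\<in>Vs. w \<notin> W \<and> (\<forall>i<length vs. Phi (vs ! i) w = rs ! i))) \<and>
     (\<forall>vs rs W. lin_indep_list p Vs zVs add smul vs \<and> length rs = length vs \<and>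
        set rs \<subseteq> {..<p} \<and> finite W \<and> W \<subseteq> V \<longrightarrow>
        (\<exists>w\<in>V. w \<notin> W \<and> (\<forall>i<length vs. Phi w (vs ! i) = rs ! i)))"

definition pg_aut ::
  "nat \<Rightarrow> 'a set \<Rightarrow> 'a set \<Rightarrow> ('a \<Rightarrow> 'a \<Rightarrow> 'a) \<Rightarrow> ('a \<Rightarrow> nat \<Rightarrow> 'a) \<Rightarrow> ('a \<Rightarrow> 'a \<Rightarrow> nat) \<Rightarrow> ('a \<Rightarrow> 'a) \<Rightarrow> bool" where
  "pg_aut p V Vs add smul Phi \<pi> \<longleftrightarrow>
     bij_betw \<pi> (V \<union> Vs) (V \<union> Vs) \<and> (\<forall>x. x \<notin> V \<union> Vs \<longrightarrow> \<pi> x = x) \<and>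
     \<pi> ` V = V \<and>
     (\<forall>u\<in>V. \<forall>v\<in>V. \<pi> (add u v) = add (\<pi> u) (\<pi> v)) \<and>
     (\<forall>u\<in>Vs. \<forall>v\<in>Vs. \<pi> (add u v) = add (\<pi> u) (\<pi> v)) \<and>
     (\<forall>u\<in>V \<union> Vs. \<forall>r<p. \<pi> (smul u r) = smul (\<pi> u) r) \<and>
     (\<forall>u\<in>V. \<forall>w\<in>Vs. Phi (\<pi> u) (\<pi> w) = Phi u w)"

context
  fixes p :: nat and V Vs :: "'a set" and add :: "'a \<Rightarrow> 'a \<Rightarrow> 'a"
    and smul :: "'a \<Rightarrow> nat \<Rightarrow> 'a" and Phi :: "'a \<Rightarrow> 'a \<Rightarrow> nat"
begin

abbreviation "Aut \<equiv> Collect (pg_aut p V Vs add smul Phi)"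

definition equivariant_tuples :: "'a list set \<Rightarrow> bool" where
  "equivariant_tuples X \<longleftrightarrow> X \<subseteq> lists (V \<union> Vs) \<and> (\<forall>\<pi>\<in>Aut. map \<pi> ` X = X)"

definition definable_tuples :: "'a list set \<Rightarrow> bool" where
  "definable_tuples X \<longleftrightarrow> equivariant_tuples X \<and>
     finite ((\<lambda>x. (\<lambda>\<pi>. map \<pi> x) ` Aut) ` X)"

definition fsupp_fun :: "('a list \<Rightarrow> nat) \<Rightarrow> bool" where
  "fsupp_fun f \<longleftrightarrow> (\<exists>S. finite S \<and> S \<subseteq> V \<union> Vs \<and>
     (\<forall>\<pi>\<in>Aut. (\<forall>s\<in>S. \<pi> s = s) \<longrightarrow> f \<circ> map \<pi> = f))"

definition fsupp_fun_set :: "('a list \<Rightarrow> nat) set \<Rightarrow> bool" where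
  "fsupp_fun_set B \<longleftrightarrow> (\<exists>S. finite S \<and> S \<subseteq> V \<union> Vs \<and>
     (\<forall>\<pi>\<in>Aut. (\<forall>s\<in>S. \<pi> s = s) \<longrightarrow> (\<lambda>f. f \<circ> map \<pi>) ` B = B))"

definition FpX :: "'a list set \<Rightarrow> ('a list \<Rightarrow> nat) set" where
  "FpX X = {f. (\<forall>x. f x < p) \<and> (\<forall>x. x \<notin> X \<longrightarrow> f x = 0) \<and> fsupp_fun f}"

definition has_zfa_basis :: "'a list set \<Rightarrow> bool" where
  "has_zfa_basis X \<longleftrightarrow> (\<exists>B. B \<subseteq> FpX X \<and> fsupp_fun_set B \<and>
     (\<forall>F c. finite F \<and> F \<subseteq> B \<and> (\<forall>x. (\<Sum>g\<in>F. c g * g x) mod p = 0)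
          \<longrightarrow> (\<forall>g\<in>F. c g mod p = 0)) \<and>
     (\<forall>f\<in>FpX X. \<exists>F c. finite F \<and> F \<subseteq> B \<and> f = (\<lambda>x. (\<Sum>g\<in>F. c g * g x) mod p)))"

end

end

theory Submission
  imports Defs "HOL-Number_Theory.Cong"
begin

text \<open>
  Every covector \<open>w\<close> is a finitely supported function \<open>f\<^sub>w = \<Phi>(-, w)\<close> on \<open>X = V\<close>. For a vector
  \<open>b\<close> and covectors \<open>a\<close> with \<open>\<Phi>(b, a) = 0\<close>, the transvections \<open>\<tau>\<^sub>a\<close> sending \<open>v\<close> to
  \<open>v + \<Phi>(v, a) b\<close> and \<open>w\<close> to \<open>w - \<Phi>(b, w) a\<close> are automorphisms. Suppose that \<open>S\<close> supports a
  basis. Choose \<open>b \<noteq> 0\<close> annihilated by the covectors in \<open>S\<close>, then \<open>w\<close> with \<open>\<Phi>(b, w) = 1\<close>, and let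
  \<open>a\<close> range over the infinite set \<open>N\<close> of covectors that annihilate \<open>b\<close> and the vectors in \<open>S\<close>.
  Each \<open>\<tau>\<^sub>a\<close> permutes the basis, fixes \<open>f\<^sub>a\<^sub>'\<close> for \<open>a'\<close> in \<open>N\<close>, and moves \<open>f\<^sub>w\<close> to \<open>f\<^sub>w + f\<^sub>a\<close>.
  Comparing coordinates, the basis elements occurring in \<open>f\<^sub>w\<close> have finite orbits under the
  \<open>\<tau>\<^sub>a\<close>, so there are only finitely many possible coordinate functions for \<open>f\<^sub>w + f\<^sub>a\<close>,
  although \<open>N\<close> is infinite.
\<close>

section \<open>Coordinates modulo p\<close>

text \<open>Coefficients form a total function, zero off a finite subset of \<open>B\<close> and
  reduced below \<open>p\<close>. This normal form makes coordinates comparable by plain equality of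
  functions.\<close>

definition coords :: "nat \<Rightarrow> ('x \<Rightarrow> nat) set \<Rightarrow> (('x \<Rightarrow> nat) \<Rightarrow> nat) \<Rightarrow> ('x \<Rightarrow> nat) \<Rightarrow> bool" where
  "coords p B k f \<longleftrightarrow> finite {g. k g \<noteq> 0} \<and> {g. k g \<noteq> 0} \<subseteq> B \<and> (\<forall>g. k g < p) \<and>
     f = (\<lambda>x. (\<Sum>g | k g \<noteq> 0. k g * g x) mod p)"

definition independent_mod :: "nat \<Rightarrow> ('x \<Rightarrow> nat) set \<Rightarrow> bool" where
  "independent_mod p B \<longleftrightarrow> (\<forall>F c. finite F \<and> F \<subseteq> B \<and> (\<forall>x. (\<Sum>g\<in>F. c g * g x) mod p = 0)
     \<longrightarrow> (\<forall>g\<in>F. c g mod p = 0))"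

lemma coords_eval: "coords p B k f \<Longrightarrow> f x = (\<Sum>g | k g \<noteq> 0. k g * g x) mod p"
  unfolding coords_def by (elim conjE) (erule fun_cong)

lemma coords_sum_superset:
  assumes "coords p B k f" "finite F" "{g. k g \<noteq> 0} \<subseteq> F"
  shows "f x = (\<Sum>g\<in>F. k g * g x) mod p"
proof -
  have "(\<Sum>g | k g \<noteq> 0. k g * g x) = (\<Sum>g\<in>F. k g * g x)"
    by (rule sum.mono_neutral_left) (use assms in auto)
  then show ?thesis using coords_eval[OF assms(1), of x] by simp
qed

lemma coords_exists:
  assumes "0 < p" "finite F" "F \<subseteq> B" "f = (\<lambda>x. (\<Sum>g\<in>F. c g * g x) mod p)"
  shows "\<exists>k. coords p B k f"
proof
  \<comment> \<open>A spanning expression leaves \<open>c\<close> arbitrary off \<open>F\<close> and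
    unreduced on it; both are normalised here.\<close>
  let ?k = "\<lambda>g. if g \<in> F then c g mod p else 0"
  have "(\<Sum>g\<in>F. c g * g x) mod p = (\<Sum>g | ?k g \<noteq> 0. ?k g * g x) mod p" for x
  proof -
    have "(\<Sum>g | ?k g \<noteq> 0. ?k g * g x) = (\<Sum>g\<in>F. ?k g * g x)"
      by (rule sum.mono_neutral_left) (use assms(2) in \<open>auto split: if_splits\<close>)
    also have "\<dots> mod p = (\<Sum>g\<in>F. (?k g * g x) mod p) mod p"
      by (simp add: mod_sum_eq)
    also have "(\<Sum>g\<in>F. (?k g * g x) mod p) = (\<Sum>g\<in>F. (c g * g x) mod p)"
      by (rule sum.cong) (auto simp: mod_mult_left_eq)
    finally show ?thesis by (simp add: mod_sum_eq)
  qed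
  moreover have "finite {g. ?k g \<noteq> 0}" "{g. ?k g \<noteq> 0} \<subseteq> B"
    using assms(2,3) by (auto intro: finite_subset[OF _ assms(2)] split: if_splits)
  ultimately show "coords p B ?k f"
    using assms(1,4) unfolding coords_def by auto
qed

lemma coords_unique:
  assumes "independent_mod p B" "coords p B k f" "coords p B l f"
  shows "k = l"
proof
  fix g
  let ?F = "{g. k g \<noteq> 0} \<union> {g. l g \<noteq> 0}"
  \<comment> \<open>The difference of the two coordinate functions, with \<open>p - l g\<close>
    standing for the negative of \<open>l g\<close> so that everything stays in the
    naturals.\<close>
  let ?c = "\<lambda>g. k g + (p - l g)"
  have F: "finite ?F" "?F \<subseteq> B" and lt: "\<And>g. k g < p" "\<And>g. l g < p"
    using assms(2,3) unfolding coords_def by auto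
  have "(\<Sum>g\<in>?F. ?c g * g x) mod p = 0" for x
  proof -
    have kl: "[(\<Sum>g\<in>?F. k g * g x) = (\<Sum>g\<in>?F. l g * g x)] (mod p)"
      using coords_sum_superset[OF assms(2) F(1)] coords_sum_superset[OF assms(3) F(1)]
      unfolding cong_def by (metis (no_types, lifting) Un_upper1 Un_upper2)
    have "(\<Sum>g\<in>?F. ?c g * g x) = (\<Sum>g\<in>?F. k g * g x) + (\<Sum>g\<in>?F. (p - l g) * g x)"
      by (simp add: algebra_simps sum.distrib)
    then have "[(\<Sum>g\<in>?F. ?c g * g x) = (\<Sum>g\<in>?F. l g * g x) + (\<Sum>g\<in>?F. (p - l g) * g x)] (mod p)"
      using kl by (simp add: cong_add)
    also have "(\<Sum>g\<in>?F. l g * g x) + (\<Sum>g\<in>?F. (p - l g) * g x) = (\<Sum>g\<in>?F. p * g x)"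
      unfolding sum.distrib[symmetric] distrib_right[symmetric]
      using lt by (intro sum.cong) (auto simp: less_imp_le)
    also have "[\<dots> = 0] (mod p)"
      by (simp add: sum_distrib_left[symmetric] cong_def)
    finally show ?thesis by (simp add: cong_def)
  qed
  then have zero: "\<forall>g\<in>?F. ?c g mod p = 0"
    using assms(1)[unfolded independent_mod_def, THEN spec[of _ ?F], THEN spec[of _ ?c]] F by simp
  show "k g = l g"
  proof (cases "g \<in> ?F")
    case True
    then have "p dvd k g + (p - l g)" using zero by (auto simp: mod_eq_0_iff_dvd)
    then obtain q where q: "k g + (p - l g) = p * q" by (auto elim: dvdE)
    \<comment> \<open>The coefficient lies strictly between 0 and \<open>2 * p\<close>, so the only
      multiple of \<open>p\<close> it can equal is \<open>p\<close> itself.\<close>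
    then have "p * 0 < p * q" "p * q < p * 2" using lt[of g] by linarith+
    then have "q = 1" by (simp only: mult_less_cancel1) linarith
    then show ?thesis using q lt[of g] by simp
  qed simp
qed

lemma coords_add:
  assumes "0 < p" "coords p B k f" "coords p B l h"
  shows "coords p B (\<lambda>g. (k g + l g) mod p) (\<lambda>x. (f x + h x) mod p)"
proof -
  let ?m = "\<lambda>g. (k g + l g) mod p"
  \<comment> \<open>Coefficients may cancel modulo \<open>p\<close> and shrink the support, so the
    sums are compared over the union of both supports.\<close>
  let ?F = "{g. k g \<noteq> 0} \<union> {g. l g \<noteq> 0}"
  have F: "finite ?F" "?F \<subseteq> B" using assms(2,3) unfolding coords_def by auto
  have sub: "{g. ?m g \<noteq> 0} \<subseteq> ?F"
  proof
    fix g assume "g \<in> {g. ?m g \<noteq> 0}"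
    then show "g \<in> ?F" by (cases "k g = 0 \<and> l g = 0") auto
  qed
  have "(f x + h x) mod p = (\<Sum>g | ?m g \<noteq> 0. ?m g * g x) mod p" for x
  proof -
    have "(f x + h x) mod p = ((\<Sum>g\<in>?F. k g * g x) + (\<Sum>g\<in>?F. l g * g x)) mod p"
      using coords_sum_superset[OF assms(2) F(1), of x] coords_sum_superset[OF assms(3) F(1), of x]
      by (simp add: mod_add_eq)
    also have "\<dots> = (\<Sum>g\<in>?F. (k g + l g) * g x) mod p"
      by (simp only: sum.distrib distrib_right)
    also have "\<dots> = (\<Sum>g\<in>?F. ?m g * g x) mod p"
      unfolding cong_def[symmetric]
      by (rule cong_sum) (simp only: cong_def mod_mult_left_eq)
    also have "(\<Sum>g\<in>?F. ?m g * g x) = (\<Sum>g | ?m g \<noteq> 0. ?m g * g x)"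
      by (rule sum.mono_neutral_right) (use F sub in auto)
    finally show ?thesis .
  qed
  then show ?thesis
    using assms(1) finite_subset[OF sub F(1)] subset_trans[OF sub F(2)]
    unfolding coords_def by (intro conjI allI ext) (assumption | simp only: mod_less_divisor)+
qed

section \<open>Substitutions acting on coordinates\<close>

lemma bij_precompose:
  assumes "bij \<sigma>"
  shows "bij (\<lambda>g. g \<circ> \<sigma>)"
  by (rule o_bij[where g = "\<lambda>g. g \<circ> inv \<sigma>"])
    (use assms in \<open>auto simp: fun_eq_iff bij_def surj_f_inv_f inv_f_f\<close>)

text \<open>Substituting \<open>\<sigma>\<close> turns the combination of the \<open>g\<close> with
  coefficients \<open>k g\<close> into that of the \<open>g \<circ> \<sigma>\<close> with the same
  coefficients. These again lie in \<open>B\<close>, so the coefficient of a basis element is that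
  of its preimage.\<close>

lemma coords_precompose:
  fixes \<sigma> :: "'x \<Rightarrow> 'x"
  assumes "coords p B k f" "bij \<sigma>" "(\<lambda>g. g \<circ> \<sigma>) ` B = B"
  shows "coords p B (k \<circ> inv (\<lambda>g. g \<circ> \<sigma>)) (f \<circ> \<sigma>)"
proof -
  let ?T = "\<lambda>g :: 'x \<Rightarrow> nat. g \<circ> \<sigma>"
  have bT: "bij ?T" by (rule bij_precompose[OF assms(2)])
  then have inv: "inv ?T (?T g) = g" for g
    using inv_f_f[OF bij_is_inj, of ?T g] by simp
  have supp: "{g. (k \<circ> inv ?T) g \<noteq> 0} = ?T ` {g. k g \<noteq> 0}"
    using bT inv by (auto simp: bij_def image_iff) (metis surj_f_inv_f)
  have "(f \<circ> \<sigma>) x = (\<Sum>g | (k \<circ> inv ?T) g \<noteq> 0. (k \<circ> inv ?T) g * g x) mod p" for x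
  proof -
    have "(\<Sum>g\<in>?T ` {g. k g \<noteq> 0}. (k \<circ> inv ?T) g * g x)
        = (\<Sum>g | k g \<noteq> 0. (k \<circ> inv ?T) (?T g) * (?T g) x)"
      by (rule sum.reindex_cong[OF inj_on_subset[OF bij_is_inj[OF bT]]]) auto
    then show ?thesis using assms(1) inv unfolding supp coords_def by simp
  qed
  moreover have "?T ` {g. k g \<noteq> 0} \<subseteq> B"
    using assms(1,3) unfolding coords_def by blast
  ultimately show ?thesis
    using assms(1) supp unfolding coords_def by auto
qed

text \<open>The combinatorial core. Uniqueness of coordinates turns \<open>h_fix\<close> into
  invariance of each \<open>l j\<close> under every substitution, and \<open>f_move\<close> into a
  recursion for \<open>k\<close>. Together they confine the images of the support of
  \<open>k\<close> to a finite set, which leaves finitely many coordinate functions for the pairwise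
  distinct translates of \<open>f\<close>.\<close>

lemma finite_translations_of_basis:
  fixes \<sigma> :: "'i \<Rightarrow> 'x \<Rightarrow> 'x" and h :: "'i \<Rightarrow> 'x \<Rightarrow> nat"
  assumes "0 < p" and indep: "independent_mod p B"
    and bij: "\<And>i. i \<in> I \<Longrightarrow> bij (\<sigma> i)"
    and inv: "\<And>i. i \<in> I \<Longrightarrow> (\<lambda>g. g \<circ> \<sigma> i) ` B = B"
    and f: "coords p B k f" and h: "\<And>i. i \<in> I \<Longrightarrow> coords p B (l i) (h i)"
    and f_move: "\<And>i. i \<in> I \<Longrightarrow> f \<circ> \<sigma> i = (\<lambda>x. (f x + h i x) mod p)"
    and h_fix: "\<And>i j. i \<in> I \<Longrightarrow> j \<in> I \<Longrightarrow> h j \<circ> \<sigma> i = h j"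
    and inj: "inj_on (\<lambda>i x. (f x + h i x) mod p) I"
  shows "finite I"
proof -
  let ?T = "\<lambda>i (g :: 'x \<Rightarrow> nat). g \<circ> \<sigma> i"
  have inv_T: "Hilbert_Choice.inv (?T i) (?T i g) = g" if "i \<in> I" for i g
    using inv_f_f[OF bij_is_inj[OF bij_precompose[OF bij[OF that]]], of g] by simp
  have l_fix: "l j (?T i g) = l j g" if "i \<in> I" "j \<in> I" for i j g
  proof -
    have "l j \<circ> Hilbert_Choice.inv (?T i) = l j"
      using coords_unique[OF indep coords_precompose[OF h[OF that(2)] bij[OF that(1)] inv[OF that(1)]]]
        h h_fix that by simp
    then show ?thesis using inv_T[OF that(1)] by (metis comp_apply)
  qed
  have k_T: "coords p B (k \<circ> Hilbert_Choice.inv (?T i)) (\<lambda>x. (f x + h i x) mod p)" if "i \<in> I" for i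
    using coords_precompose[OF f bij[OF that] inv[OF that]] f_move[OF that] by simp
  have k_move: "k g = (k (?T i g) + l i (?T i g)) mod p" if "i \<in> I" for i g
  proof -
    have "k \<circ> Hilbert_Choice.inv (?T i) = (\<lambda>g. (k g + l i g) mod p)"
      using coords_unique[OF indep k_T[OF that] coords_add[OF assms(1) f h[OF that]]] .
    then show ?thesis using inv_T[OF that] by (metis comp_apply)
  qed
  \<comment> \<open>If some \<open>l j\<close> is nonzero at \<open>g\<close>, invariance keeps all
    images of \<open>g\<close> in the finite support of \<open>l j\<close>. Otherwise the correction
    term in \<open>k_move\<close> vanishes along the images of \<open>g\<close>, so they stay in the
    support of \<open>k\<close>.\<close>
  have orbit: "finite ((\<lambda>i. ?T i g) ` I)" if g: "k g \<noteq> 0" for g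
  proof (cases "\<exists>j\<in>I. l j g \<noteq> 0")
    case True
    then obtain j where j: "j \<in> I" "l j g \<noteq> 0" by blast
    have "(\<lambda>i. ?T i g) ` I \<subseteq> {g. l j g \<noteq> 0}" using l_fix j by auto
    then show ?thesis using h[OF j(1)] unfolding coords_def by (meson finite_subset)
  next
    case False
    have "k (?T i g) \<noteq> 0" if "i \<in> I" for i
    proof
      assume "k (?T i g) = 0"
      moreover have "l i (?T i g) = 0" using l_fix[OF that that] False that by auto
      ultimately show False using k_move[OF that, of g] g by simp
    qed
    then have "(\<lambda>i. ?T i g) ` I \<subseteq> {g. k g \<noteq> 0}" by auto
    then show ?thesis using f unfolding coords_def by (meson finite_subset)
  qed
  \<comment> \<open>One finite set containing the supports of the coordinates of all translates of
    \<open>f\<close>.\<close>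
  let ?U = "\<Union>g\<in>{g. k g \<noteq> 0}. (\<lambda>i. ?T i g) ` I"
  have "finite ?U" using orbit f unfolding coords_def by blast
  then have fin: "finite {m. (\<forall>g. (g \<in> ?U \<longrightarrow> m g \<in> {..<p}) \<and> (g \<notin> ?U \<longrightarrow> m g = 0))}"
    by (rule finite_set_of_finite_funs) simp
  have "k \<circ> Hilbert_Choice.inv (?T i) \<in> {m. (\<forall>g. (g \<in> ?U \<longrightarrow> m g \<in> {..<p}) \<and> (g \<notin> ?U \<longrightarrow> m g = 0))}"
    if "i \<in> I" for i
  proof -
    have "g \<in> ?U" if nz: "k (Hilbert_Choice.inv (?T i) g) \<noteq> 0" for g
    proof -
      have "g = ?T i (Hilbert_Choice.inv (?T i) g)"
        using surj_f_inv_f[OF bij_is_surj[OF bij_precompose[OF bij[OF \<open>i \<in> I\<close>]]], of g] by simp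
      then show ?thesis using nz \<open>i \<in> I\<close> by blast
    qed
    moreover have "k g < p" for g using f unfolding coords_def by blast
    ultimately show ?thesis unfolding mem_Collect_eq comp_apply lessThan_iff by blast
  qed
  then have "finite ((\<lambda>i. k \<circ> Hilbert_Choice.inv (?T i)) ` I)"
    by (rule finite_subset[OF image_subsetI fin])
  moreover have "inj_on (\<lambda>i. k \<circ> Hilbert_Choice.inv (?T i)) I"
  proof (rule inj_onI)
    fix i j assume ij: "i \<in> I" "j \<in> I"
      and eq: "k \<circ> Hilbert_Choice.inv (?T i) = k \<circ> Hilbert_Choice.inv (?T j)"
    have "(\<lambda>x. (f x + h i x) mod p) = (\<lambda>x. (f x + h j x) mod p)"
      using coords_eval[OF k_T[OF ij(1)]] coords_eval[OF k_T[OF ij(2)]] unfolding eq by simp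
    then show "i = j" using inj ij by (auto dest: inj_onD)
  qed
  ultimately show ?thesis by (rule finite_imageD)
qed

section \<open>Vector spaces over the prime field\<close>

locale fp_space =
  fixes p :: nat and C :: "'a set" and z :: 'a
    and add :: "'a \<Rightarrow> 'a \<Rightarrow> 'a" and smul :: "'a \<Rightarrow> nat \<Rightarrow> 'a"
  assumes prime: "prime p" and space: "fp_vector_space p C z add smul"
begin

lemma p_pos: "0 < p" using prime by (rule prime_gt_0_nat)

lemma p_gt_1: "1 < p" using prime by (rule prime_gt_1_nat)

lemma zero_closed: "z \<in> C"
  and add_closed: "u \<in> C \<Longrightarrow> v \<in> C \<Longrightarrow> add u v \<in> C"
  and smul_closed: "u \<in> C \<Longrightarrow> r < p \<Longrightarrow> smul u r \<in> C"
  and add_assoc: "u \<in> C \<Longrightarrow> v \<in> C \<Longrightarrow> w \<in> C \<Longrightarrow> add (add u v) w = add u (add v w)"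
  and add_commute: "u \<in> C \<Longrightarrow> v \<in> C \<Longrightarrow> add u v = add v u"
  and add_zero: "u \<in> C \<Longrightarrow> add u z = u"
  and smul_one: "u \<in> C \<Longrightarrow> smul u 1 = u"
  and smul_smul: "u \<in> C \<Longrightarrow> r < p \<Longrightarrow> s < p \<Longrightarrow> smul (smul u r) s = smul u ((r * s) mod p)"
  and smul_add_left: "u \<in> C \<Longrightarrow> r < p \<Longrightarrow> s < p \<Longrightarrow> smul u ((r + s) mod p) = add (smul u r) (smul u s)"
  and smul_add_right: "u \<in> C \<Longrightarrow> v \<in> C \<Longrightarrow> r < p \<Longrightarrow> smul (add u v) r = add (smul u r) (smul v r)"
  using space unfolding fp_vector_space_def by - (elim conjE; simp)+

lemma negative_exists: "\<forall>u\<in>C. \<exists>v\<in>C. add u v = z"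
  using space unfolding fp_vector_space_def by (elim conjE)

lemma add_left_cancel:
  assumes "u \<in> C" "v \<in> C" "w \<in> C" "add u v = add u w"
  shows "v = w"
proof -
  obtain n where n: "n \<in> C" "add u n = z"
    using negative_exists assms(1) by blast
  have "add (add n u) v = add (add n u) w" using assms n by (simp add: add_assoc)
  then show ?thesis using assms n add_commute add_zero zero_closed by metis
qed

lemma add_right_cancel:
  assumes "u \<in> C" "v \<in> C" "w \<in> C" "add v u = add w u"
  shows "v = w"
  using add_left_cancel assms add_commute by metis

lemma smul_zero: "u \<in> C \<Longrightarrow> smul u 0 = z"
  using smul_add_left[of u 0 0] p_pos add_left_cancel smul_closed zero_closed add_zero
  by (metis add_0 mod_0)

lemma zero_smul: "r < p \<Longrightarrow> smul z r = z"
  using smul_add_right[of z z r] add_left_cancel smul_closed zero_closed add_zero by metis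

text \<open>The residue \<open>p - 1\<close> plays the role of -1, here and in all later
  differences.\<close>

lemma add_smul_neg:
  assumes "u \<in> C" "r < p"
  shows "add (smul u ((p - 1) * r mod p)) (smul u r) = z"
proof -
  have "((p - 1) * r mod p + r) mod p = ((p - 1) * r + r) mod p"
    by (simp add: mod_add_left_eq)
  also have "(p - 1) * r + r = p * r"
    using p_pos by (cases p) auto
  finally show ?thesis
    using smul_add_left[OF assms(1), of "(p - 1) * r mod p" r] assms p_pos smul_zero by simp
qed

lemma add_neg: "u \<in> C \<Longrightarrow> add (smul u (p - 1)) u = z"
  using add_smul_neg[of u 1] p_gt_1 smul_one by simp

text \<open>Primality enters here: it makes \<open>r\<close> coprime to \<open>p\<close>, hence
  invertible.\<close>

lemma mult_inverse_mod:
  assumes "0 < r" "r < p"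
  obtains s where "s < p" "(r * s) mod p = 1"
proof -
  have "coprime r p"
    using assms prime by (meson coprime_commute nat_dvd_not_less prime_imp_coprime_nat)
  then obtain s where "[r * s = 1] (mod p)" using cong_solve_coprime_nat by auto
  then have "(r * (s mod p)) mod p = 1" using p_gt_1 by (simp add: cong_def mod_mult_right_eq)
  then show ?thesis using that p_pos by (meson mod_less_divisor)
qed

lemma smul_eq_zero:
  assumes "u \<in> C" "r < p" "smul u r = z" "u \<noteq> z"
  shows "r = 0"
proof (rule ccontr)
  assume "r \<noteq> 0"
  then obtain s where s: "s < p" "(r * s) mod p = 1" using mult_inverse_mod assms(2) by blast
  then have "u = smul (smul u r) s"
    using smul_smul[OF assms(1,2) s(1)] smul_one[OF assms(1)] by simp
  then show False using assms s zero_smul by metis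
qed

lemma lin_indep_list_single:
  assumes "u \<in> C" "u \<noteq> z"
  shows "lin_indep_list p C z add smul [u]"
  unfolding lin_indep_list_def
  using assms smul_eq_zero smul_closed add_zero
  by (auto simp: lincomb_def length_Suc_conv)

lemma lin_indep_list_pair:
  assumes "u \<in> C" "u \<noteq> z" "v \<in> C" "\<And>r. r < p \<Longrightarrow> v \<noteq> smul u r"
  shows "lin_indep_list p C z add smul [u, v]"
proof -
  have "r = 0 \<and> s = 0" if rs: "r < p" "s < p" "add (smul u r) (add (smul v s) z) = z" for r s
  proof -
    have eq: "add (smul u r) (smul v s) = z" using rs assms smul_closed add_zero by simp
    have "s = 0"
    proof (rule ccontr)
      assume "s \<noteq> 0"
      \<comment> \<open>Multiplying the relation by the inverse of \<open>s\<close> solves it for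
        \<open>v\<close> and exhibits \<open>v\<close> as a multiple of \<open>u\<close>.\<close>
      then obtain t where t: "t < p" "(s * t) mod p = 1" using mult_inverse_mod rs(2) by blast
      let ?q = "r * t mod p"
      have "z = smul (add (smul u r) (smul v s)) t" using eq t zero_smul by simp
      also have "\<dots> = add (smul u ?q) v"
        using t rs assms smul_add_right smul_closed smul_smul smul_one by simp
      finally have sum: "add (smul u ?q) v = z" ..
      have "add (smul u ?q) (smul (smul u ?q) (p - 1)) = z"
        using add_neg[of "smul u ?q"] add_commute smul_closed assms p_pos
        by (metis diff_less less_numeral_extra(1) mod_less_divisor)
      then have "v = smul (smul u ?q) (p - 1)"
        using sum add_left_cancel assms smul_closed p_pos
        by (metis diff_less less_numeral_extra(1) mod_less_divisor)
      then have "v = smul u ((?q * (p - 1)) mod p)" using smul_smul assms p_pos by simp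
      then show False using assms(4) p_pos by simp
    qed
    moreover have "r = 0"
      using eq smul_eq_zero[of u r] assms rs smul_zero smul_closed add_zero \<open>s = 0\<close> by metis
    ultimately show ?thesis by simp
  qed
  then show ?thesis
    using assms unfolding lin_indep_list_def by (auto simp: lincomb_def length_Suc_conv)
qed

section \<open>Linear functionals, transvections of one space, and common kernels\<close>

definition functional :: "('a \<Rightarrow> nat) \<Rightarrow> bool" where
  "functional \<phi> \<longleftrightarrow> (\<forall>u\<in>C. \<phi> u < p) \<and>
     (\<forall>u\<in>C. \<forall>v\<in>C. \<phi> (add u v) = (\<phi> u + \<phi> v) mod p) \<and>
     (\<forall>u\<in>C. \<forall>r<p. \<phi> (smul u r) = (r * \<phi> u) mod p)"

lemma functional_neg:
  assumes "functional \<phi>"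
  shows "functional (\<lambda>u. (p - 1) * \<phi> u mod p)"
  using assms p_pos unfolding functional_def
  by (auto simp: mod_simps distrib_left mult.left_commute)

text \<open>Since \<open>\<phi> b = 0\<close>, adding multiples of \<open>b\<close> leaves
  \<open>\<phi>\<close> unchanged. The inverse therefore subtracts the same multiple of
  \<open>b\<close>.\<close>

lemma transvection_bij:
  assumes "functional \<phi>" "b \<in> C" "\<phi> b = 0"
  shows "bij_betw (\<lambda>u. add u (smul b (\<phi> u))) C C"
proof -
  let ?t = "\<lambda>u. add u (smul b (\<phi> u))"
  have lt: "\<phi> u < p" if "u \<in> C" for u using assms that unfolding functional_def by blast
  have shift: "\<phi> (add u (smul b r)) = \<phi> u" if "u \<in> C" "r < p" for u r
    using assms that smul_closed[of b r] lt[of u] unfolding functional_def by simp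
  have "inj_on ?t C"
  proof (rule inj_onI)
    fix u v assume uv: "u \<in> C" "v \<in> C" "?t u = ?t v"
    then have "\<phi> u = \<phi> v" using shift lt by metis
    then show "u = v" using uv add_right_cancel smul_closed assms(2) lt by metis
  qed
  moreover have "?t ` C \<subseteq> C" using add_closed smul_closed assms(2) lt by auto
  moreover have "C \<subseteq> ?t ` C"
  proof
    fix u assume u: "u \<in> C"
    let ?n = "(p - 1) * \<phi> u mod p"
    let ?v = "add u (smul b ?n)"
    have n: "?n < p" using p_pos by simp
    have "?t ?v = add (add u (smul b ?n)) (smul b (\<phi> u))" using shift u n by simp
    also have "\<dots> = u"
      using u n add_assoc smul_closed assms(2) lt add_smul_neg add_zero by simp
    finally have "u = ?t ?v" by (rule sym)
    moreover have "?v \<in> C" using u n add_closed smul_closed assms(2) by blast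
    ultimately show "u \<in> ?t ` C" by (rule image_eqI)
  qed
  ultimately show ?thesis unfolding bij_betw_def by blast
qed

lemma transvection_add:
  assumes "functional \<phi>" "b \<in> C" "u \<in> C" "v \<in> C"
  shows "add (add u v) (smul b (\<phi> (add u v))) = add (add u (smul b (\<phi> u))) (add v (smul b (\<phi> v)))"
proof -
  have lt: "\<phi> u < p" "\<phi> v < p" using assms unfolding functional_def by auto
  let ?x = "smul b (\<phi> u)" and ?y = "smul b (\<phi> v)"
  have C: "?x \<in> C" "?y \<in> C" using smul_closed assms lt by auto
  have "smul b (\<phi> (add u v)) = add ?x ?y"
    using assms lt smul_add_left unfolding functional_def by simp
  moreover have "add (add u v) (add ?x ?y) = add u (add (add v ?x) ?y)"
    using C assms by (simp add: add_assoc add_closed)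
  moreover have "add v ?x = add ?x v" using C assms by (simp add: add_commute)
  moreover have "add u (add (add ?x v) ?y) = add (add u ?x) (add v ?y)"
    using C assms by (simp add: add_assoc add_closed)
  ultimately show ?thesis by simp
qed

lemma transvection_smul:
  assumes "functional \<phi>" "b \<in> C" "u \<in> C" "r < p"
  shows "add (smul u r) (smul b (\<phi> (smul u r))) = smul (add u (smul b (\<phi> u))) r"
  using assms smul_add_right smul_closed smul_smul
  unfolding functional_def by (simp add: mult.commute)

text \<open>Finitely many functionals take only finitely many value patterns, so one pattern is
  shared by infinitely many vectors. Subtracting one of these from all of them gives infinitely many
  common zeros.\<close>

lemma infinite_common_zeros:
  assumes "infinite C" "finite \<Phi>" "\<And>\<phi>. \<phi> \<in> \<Phi> \<Longrightarrow> functional \<phi>"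
  shows "infinite {u \<in> C. \<forall>\<phi>\<in>\<Phi>. \<phi> u = 0}"
proof -
  let ?vals = "\<lambda>u. (\<lambda>\<phi>. if \<phi> \<in> \<Phi> then \<phi> u else 0)"
  have "?vals ` C \<subseteq> {m. \<forall>\<phi>. (\<phi> \<in> \<Phi> \<longrightarrow> m \<phi> \<in> {..<p}) \<and> (\<phi> \<notin> \<Phi> \<longrightarrow> m \<phi> = 0)}"
    using assms(3) unfolding functional_def by auto
  then have "finite (?vals ` C)"
    by (rule finite_subset) (rule finite_set_of_finite_funs[OF assms(2)], simp)
  then obtain c where c: "c \<in> C" "infinite {u \<in> C. ?vals u = ?vals c}"
    using pigeonhole_infinite[OF assms(1)] by auto
  let ?n = "smul c (p - 1)"
  let ?K = "{u \<in> C. ?vals u = ?vals c}"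
  have n: "?n \<in> C" using c p_pos smul_closed by simp
  have "inj_on (\<lambda>u. add u ?n) ?K"
    using add_right_cancel n by (auto intro!: inj_onI)
  then have "infinite ((\<lambda>u. add u ?n) ` ?K)" using c(2) finite_imageD[of _ ?K] by blast
  moreover have "(\<lambda>u. add u ?n) ` ?K \<subseteq> {u \<in> C. \<forall>\<phi>\<in>\<Phi>. \<phi> u = 0}"
  proof (rule image_subsetI)
    fix u assume "u \<in> ?K"
    then have u: "u \<in> C" "?vals u = ?vals c" by blast+
    have "\<phi> (add u ?n) = 0" if "\<phi> \<in> \<Phi>" for \<phi>
    proof -
      have F: "functional \<phi>" using assms(3) that by blast
      have "\<phi> u = \<phi> c" using fun_cong[OF u(2), of \<phi>] that by simp
      then have "\<phi> (add u ?n) = \<phi> (add c ?n)"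
        using F u c n unfolding functional_def by simp
      \<comment> \<open>Writing the zero vector as a multiple by 0 lets homogeneity give the value
        0.\<close>
      also have "add c ?n = smul c 0"
        using c n add_neg add_commute smul_zero by metis
      also have "\<phi> (smul c 0) = 0" using F c p_pos unfolding functional_def by simp
      finally show ?thesis .
    qed
    then show "add u ?n \<in> {u \<in> C. \<forall>\<phi>\<in>\<Phi>. \<phi> u = 0}"
      using u n add_closed by blast
  qed
  ultimately show ?thesis using finite_subset by blast
qed

end

section \<open>Transvections of the polar geometry\<close>

locale polar =
  fixes p :: nat and V Vs :: "'a set" and zV zVs :: 'a
    and add :: "'a \<Rightarrow> 'a \<Rightarrow> 'a" and smul :: "'a \<Rightarrow> nat \<Rightarrow> 'a" and Phi :: "'a \<Rightarrow> 'a \<Rightarrow> nat"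
  assumes prime: "prime p" and geometry: "polar_geometry p V Vs zV zVs add smul Phi"
begin

sublocale V: fp_space p V zV add smul
  using prime geometry unfolding polar_geometry_def by unfold_locales blast+

sublocale Vs: fp_space p Vs zVs add smul
  using prime geometry unfolding polar_geometry_def by unfold_locales blast+

lemma disjoint: "V \<inter> Vs = {}"
  and infinite_V: "infinite V" and infinite_Vs: "infinite Vs"
  using geometry unfolding polar_geometry_def by - (elim conjE; assumption)+

lemma Phi_less: "u \<in> V \<Longrightarrow> w \<in> Vs \<Longrightarrow> Phi u w < p"
  and Phi_add_left: "u \<in> V \<Longrightarrow> u' \<in> V \<Longrightarrow> w \<in> Vs \<Longrightarrow> Phi (add u u') w = (Phi u w + Phi u' w) mod p"
  and Phi_add_right: "u \<in> V \<Longrightarrow> w \<in> Vs \<Longrightarrow> w' \<in> Vs \<Longrightarrow> Phi u (add w w') = (Phi u w + Phi u w') mod p"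
  and Phi_smul_left: "u \<in> V \<Longrightarrow> w \<in> Vs \<Longrightarrow> r < p \<Longrightarrow> Phi (smul u r) w = (r * Phi u w) mod p"
  and Phi_smul_right: "u \<in> V \<Longrightarrow> w \<in> Vs \<Longrightarrow> r < p \<Longrightarrow> Phi u (smul w r) = (r * Phi u w) mod p"
  using geometry unfolding polar_geometry_def by - (elim conjE; simp)+

lemma functional_left: "w \<in> Vs \<Longrightarrow> V.functional (\<lambda>u. Phi u w)"
  unfolding V.functional_def by (simp add: Phi_less Phi_add_left Phi_smul_left)

lemma functional_right: "u \<in> V \<Longrightarrow> Vs.functional (\<lambda>w. Phi u w)"
  unfolding Vs.functional_def by (simp add: Phi_less Phi_add_right Phi_smul_right)

lemma extension_Vs:
  assumes "lin_indep_list p V zV add smul vs" "length rs = length vs" "set rs \<subseteq> {..<p}"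
  obtains w where "w \<in> Vs" "\<And>i. i < length vs \<Longrightarrow> Phi (vs ! i) w = rs ! i"
proof -
  have "\<exists>w\<in>Vs. w \<notin> {} \<and> (\<forall>i<length vs. Phi (vs ! i) w = rs ! i)"
    using geometry assms unfolding polar_geometry_def by blast
  then show ?thesis using that by blast
qed

lemma extension_V:
  assumes "lin_indep_list p Vs zVs add smul ws" "length rs = length ws" "set rs \<subseteq> {..<p}"
  obtains u where "u \<in> V" "\<And>i. i < length ws \<Longrightarrow> Phi u (ws ! i) = rs ! i"
proof -
  have "\<exists>u\<in>V. u \<notin> {} \<and> (\<forall>i<length ws. Phi u (ws ! i) = rs ! i)"
    using geometry assms unfolding polar_geometry_def by blast
  then show ?thesis using that by blast
qed

text \<open>The pairing separates covectors: a nonzero difference forms an independent list, so the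
  Space Extension Axiom yields a vector pairing to 1 with it.\<close>

lemma covector_eqI:
  assumes "w \<in> Vs" "w' \<in> Vs" "\<And>u. u \<in> V \<Longrightarrow> Phi u w = Phi u w'"
  shows "w = w'"
proof (rule ccontr)
  assume ne: "w \<noteq> w'"
  let ?n = "smul w' (p - 1)"
  let ?d = "add w ?n"
  have n: "?n \<in> Vs" using assms Vs.smul_closed Vs.p_pos by simp
  have w'n: "add w' ?n = zVs" using Vs.add_neg Vs.add_commute n assms(2) by metis
  have d: "?d \<in> Vs" using n assms Vs.add_closed by simp
  have "?d \<noteq> zVs" using w'n ne Vs.add_right_cancel[OF n] assms by metis
  then obtain u where u: "u \<in> V" "Phi u ?d = 1"
    using extension_V[OF Vs.lin_indep_list_single[OF d], of "[1]"] Vs.p_gt_1 by auto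
  have "Phi u ?d = Phi u (add w' ?n)" using Phi_add_right u n assms by simp
  also have "\<dots> = Phi u (smul zVs 0)" using w'n Vs.zero_smul Vs.p_pos by simp
  also have "\<dots> = 0" using Phi_smul_right u Vs.zero_closed Vs.p_pos by simp
  finally show False using u by simp
qed

text \<open>The factor \<open>p - 1\<close> is \<open>-1\<close> in \<open>F\<^sub>p\<close>.\<close>
definition transvection :: "'a \<Rightarrow> 'a \<Rightarrow> 'a \<Rightarrow> 'a" where
  "transvection b a x =
     (if x \<in> V then add x (smul b (Phi x a))
      else if x \<in> Vs then add x (smul a ((p - 1) * Phi b x mod p)) else x)"

lemma transvection_V: "x \<in> V \<Longrightarrow> transvection b a x = add x (smul b (Phi x a))"
  unfolding transvection_def by simp

lemma transvection_Vs: "x \<in> Vs \<Longrightarrow> transvection b a x = add x (smul a ((p - 1) * Phi b x mod p))"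
  using disjoint unfolding transvection_def by auto

text \<open>Expanding gives two cross terms \<open>Phi u a * Phi b w\<close> of opposite sign, which
  cancel, and a term containing \<open>Phi b a\<close>, which is zero.\<close>

lemma Phi_transvection:
  assumes b: "b \<in> V" and a: "a \<in> Vs" "Phi b a = 0" and u: "u \<in> V" and w: "w \<in> Vs"
  shows "Phi (transvection b a u) (transvection b a w) = Phi u w"
proof -
  let ?r = "Phi u a" and ?s = "(p - 1) * Phi b w mod p"
  have r: "?r < p" using Phi_less u a by blast
  have br: "smul b ?r \<in> V" "add u (smul b ?r) \<in> V"
    using V.smul_closed V.add_closed r b u by auto
  have expand: "Phi (add u (smul b ?r)) (add w (smul a s)) = (Phi u w + ?r * Phi b w + s * ?r) mod p"
    if "s < p" for s
    using that u w a b r br Vs.smul_closed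
    by (simp add: Phi_add_left Phi_add_right Phi_smul_left Phi_smul_right mod_simps)
  have "Phi (transvection b a u) (transvection b a w) = (Phi u w + ?r * Phi b w + ?s * ?r) mod p"
    using expand[of ?s] V.p_pos u w by (simp add: transvection_V transvection_Vs)
  also have "\<dots> = (Phi u w + ?r * Phi b w + ((p - 1) * Phi b w) * ?r) mod p"
    by (metis mod_add_right_eq mod_mult_left_eq)
  also have "Phi u w + ?r * Phi b w + ((p - 1) * Phi b w) * ?r = Phi u w + p * (?r * Phi b w)"
    using V.p_pos by (cases p) (auto simp: algebra_simps)
  finally show ?thesis using Phi_less u w by simp
qed

lemma transvection_aut:
  assumes b: "b \<in> V" and a: "a \<in> Vs" "Phi b a = 0"
  shows "pg_aut p V Vs add smul Phi (transvection b a)"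
proof -
  let ?t = "transvection b a"
  let ?\<phi> = "\<lambda>u. Phi u a" and ?\<psi> = "\<lambda>w. (p - 1) * Phi b w mod p"
  have f: "V.functional ?\<phi>" using functional_left a by blast
  have g: "Vs.functional ?\<psi>" using Vs.functional_neg functional_right b by blast
  have bV: "bij_betw ?t V V"
    using V.transvection_bij[OF f b a(2)] by (simp add: transvection_V cong: bij_betw_cong)
  have bVs: "bij_betw ?t Vs Vs"
    using Vs.transvection_bij[OF g a(1)] a(2) by (simp add: transvection_Vs cong: bij_betw_cong)
  have "bij_betw ?t (V \<union> Vs) (V \<union> Vs)"
    using bij_betw_combine[OF bV bVs disjoint] .
  moreover have "?t ` V = V" using bV by (simp add: bij_betw_def)
  moreover have "\<forall>x. x \<notin> V \<union> Vs \<longrightarrow> ?t x = x" unfolding transvection_def by simp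
  moreover have "\<forall>u\<in>V. \<forall>v\<in>V. ?t (add u v) = add (?t u) (?t v)"
    using V.transvection_add[OF f b] V.add_closed by (simp add: transvection_V)
  moreover have "\<forall>u\<in>Vs. \<forall>v\<in>Vs. ?t (add u v) = add (?t u) (?t v)"
    using Vs.transvection_add[OF g a(1)] Vs.add_closed by (simp add: transvection_Vs)
  moreover have "\<forall>u\<in>V \<union> Vs. \<forall>r<p. ?t (smul u r) = smul (?t u) r"
    using V.transvection_smul[OF f b] V.smul_closed Vs.transvection_smul[OF g a(1)] Vs.smul_closed
    by (auto simp: transvection_V transvection_Vs)
  moreover have "\<forall>u\<in>V. \<forall>w\<in>Vs. Phi (?t u) (?t w) = Phi u w"
    using Phi_transvection assms by blast
  ultimately show ?thesis unfolding pg_aut_def by blast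
qed

section \<open>Automorphisms and the orbits of vectors\<close>

lemma pg_aut_comp:
  assumes "pg_aut p V Vs add smul Phi \<pi>" "pg_aut p V Vs add smul Phi \<rho>"
  shows "pg_aut p V Vs add smul Phi (\<pi> \<circ> \<rho>)"
proof -
  \<comment> \<open>\<open>pg_aut\<close> prescribes the image of \<open>V\<close> only; that of
    \<open>Vs\<close> follows by taking complements.\<close>
  have Vs_image: "\<sigma> ` Vs = Vs" if "pg_aut p V Vs add smul Phi \<sigma>" for \<sigma>
  proof -
    have b: "bij_betw \<sigma> (V \<union> Vs) (V \<union> Vs)" and V: "\<sigma> ` V = V"
      using that unfolding pg_aut_def by blast+
    have "Vs = (V \<union> Vs) - V" using disjoint by blast
    then show ?thesis
      using b V inj_on_image_set_diff[of \<sigma> "V \<union> Vs" "V \<union> Vs" V] unfolding bij_betw_def by auto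
  qed
  have V: "\<rho> u \<in> V" if "u \<in> V" for u using assms(2) that unfolding pg_aut_def by blast
  have Vs: "\<rho> u \<in> Vs" if "u \<in> Vs" for u using Vs_image[OF assms(2)] that by blast
  have "(\<pi> \<circ> \<rho>) ` V = V"
    using assms unfolding pg_aut_def by (simp only: image_comp[symmetric])
  then show ?thesis
    using assms bij_betw_trans[of \<rho> "V \<union> Vs" "V \<union> Vs" \<pi> "V \<union> Vs"] V Vs
    unfolding pg_aut_def by (simp add: ball_Un)
qed

text \<open>Automorphisms are the identity off the atoms, so they are bijections of the whole type,
  as precomposition on functions of arbitrary lists requires.\<close>

lemma aut_bij:
  assumes "pg_aut p V Vs add smul Phi \<pi>"
  shows "bij \<pi>"
proof -
  have "bij_betw \<pi> (- (V \<union> Vs)) (- (V \<union> Vs))"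
    using assms bij_betw_cong[of "- (V \<union> Vs)" \<pi> id] bij_betw_id unfolding pg_aut_def by auto
  then have "bij_betw \<pi> ((V \<union> Vs) \<union> - (V \<union> Vs)) ((V \<union> Vs) \<union> - (V \<union> Vs))"
    using assms unfolding pg_aut_def by (elim conjE) (rule bij_betw_combine, assumption+, blast)
  then show ?thesis by (simp only: Compl_partition)
qed

text \<open>Take the transvection along \<open>v - u\<close>: the covector \<open>a\<close>
  annihilates this difference, and \<open>u + Phi u a * (v - u) = v\<close>.\<close>

lemma exists_aut_moving:
  assumes "u \<in> V" "v \<in> V" "a \<in> Vs" "Phi u a = 1" "Phi v a = 1"
  shows "\<exists>\<pi>. pg_aut p V Vs add smul Phi \<pi> \<and> \<pi> u = v"
proof -
  let ?n = "smul u (p - 1)"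
  let ?b = "add v ?n"
  have n: "?n \<in> V" using assms V.smul_closed V.p_pos by simp
  have b: "?b \<in> V" using n assms V.add_closed by simp
  have "Phi ?b a = (1 + (p - 1)) mod p"
    using assms n V.p_pos by (simp add: Phi_add_left Phi_smul_left mod_simps)
  then have "Phi ?b a = 0" using V.p_pos by simp
  then have "pg_aut p V Vs add smul Phi (transvection ?b a)"
    using transvection_aut b assms by blast
  moreover have "transvection ?b a u = add u (add v ?n)"
    using assms b by (simp add: transvection_V V.smul_one[simplified])
  moreover have "add u (add v ?n) = add (add v ?n) u" using V.add_commute b assms by blast
  moreover have "add (add v ?n) u = v"
    using assms n V.add_neg V.add_zero by (simp add: V.add_assoc)
  ultimately show ?thesis by auto
qed

text \<open>Fix a nonzero \<open>c\<close>. All vectors off the line of \<open>c\<close> share the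
  orbit of \<open>c\<close>, and the line has at most \<open>p\<close> elements, so there are
  finitely many orbits.\<close>

lemma definable_vectors: "definable_tuples p V Vs add smul Phi ((\<lambda>v. [v]) ` V)"
proof -
  \<comment> \<open>Equivariant sets are encoded as sets of tuples, so \<open>V\<close> appears as
    its one-element lists.\<close>
  let ?X = "(\<lambda>v. [v]) ` V"
  let ?A = "Collect (pg_aut p V Vs add smul Phi)"
  let ?orb = "\<lambda>x. (\<lambda>\<pi>. map \<pi> x) ` ?A"
  have "map \<pi> ` ?X = ?X" if "\<pi> \<in> ?A" for \<pi>
  proof -
    have "\<pi> ` V = V" using that unfolding pg_aut_def by simp
    moreover have "map \<pi> ` ?X = (\<lambda>v. [v]) ` (\<pi> ` V)" by (simp add: image_image)
    ultimately show ?thesis by simp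
  qed
  then have equi: "equivariant_tuples p V Vs add smul Phi ?X"
    unfolding equivariant_tuples_def by auto
  have "infinite (V - {zV})" using infinite_V by simp
  then obtain c where c: "c \<in> V" "c \<noteq> zV"
    by (metis Diff_iff ex_in_conv finite.emptyI insertCI)
  \<comment> \<open>Inclusion needs composition only. Equality of orbits then comes from moving
    \<open>c\<close> to \<open>v\<close> and \<open>v\<close> to \<open>c\<close>, without inverting
    automorphisms.\<close>
  have sub: "?orb [v] \<subseteq> ?orb [u]" if "pg_aut p V Vs add smul Phi \<pi>" "\<pi> u = v" for u v \<pi>
    using that pg_aut_comp by (fastforce simp: image_iff)
  have "?orb [v] = ?orb [c]" if v: "v \<in> V" "\<And>r. r < p \<Longrightarrow> v \<noteq> smul c r" for v
  proof -
    have "lin_indep_list p V zV add smul [c, v]"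
      using V.lin_indep_list_pair c v by blast
    \<comment> \<open>Independence of \<open>c\<close> and \<open>v\<close> lets the Space Extension
      Axiom prescribe the value 1 on both.\<close>
    then obtain a where a: "a \<in> Vs" "\<And>i. i < length [c, v] \<Longrightarrow> Phi ([c, v] ! i) a = [1, 1] ! i"
      by (rule extension_Vs[where rs = "[1, 1]"]) (use V.p_gt_1 in auto)
    have "Phi c a = 1" "Phi v a = 1" using a(2)[of 0] a(2)[of 1] by auto
    then show ?thesis using exists_aut_moving[of c v a] exists_aut_moving[of v c a] a(1) c v sub
      by (metis subset_antisym)
  qed
  note generic = this
  have "?orb ` ?X \<subseteq> insert (?orb [c]) ((\<lambda>r. ?orb [smul c r]) ` {..<p})"
  proof (intro image_subsetI, elim imageE, hypsubst)
    fix v assume v: "v \<in> V"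
    show "?orb [v] \<in> insert (?orb [c]) ((\<lambda>r. ?orb [smul c r]) ` {..<p})"
    proof (cases "\<exists>r<p. v = smul c r")
      case True
      then show ?thesis by blast
    next
      case False
      then show ?thesis using generic[OF v] by blast
    qed
  qed
  then have "finite (?orb ` ?X)" by (rule finite_subset) simp
  then show ?thesis using equi unfolding definable_tuples_def by blast
qed

section \<open>Covectors as finitely supported functions on the vectors\<close>

definition pairing :: "'a \<Rightarrow> 'a list \<Rightarrow> nat" where
  "pairing w x = (if \<exists>v\<in>V. x = [v] then Phi (hd x) w else 0)"

lemma pairing_single: "v \<in> V \<Longrightarrow> pairing w [v] = Phi v w"
  unfolding pairing_def by simp

text \<open>The default value 0 is forced by \<open>FpX\<close>, whose members vanish off the index
  set.\<close>

lemma pairing_outside: "x \<notin> (\<lambda>v. [v]) ` V \<Longrightarrow> pairing w x = 0"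
  unfolding pairing_def by auto

lemma map_aut_single_iff:
  assumes "pg_aut p V Vs add smul Phi \<pi>"
  shows "map \<pi> x \<in> (\<lambda>v. [v]) ` V \<longleftrightarrow> x \<in> (\<lambda>v. [v]) ` V"
proof -
  have "\<pi> v \<in> V \<longleftrightarrow> v \<in> V" for v
    using assms aut_bij[OF assms] inj_image_mem_iff[of \<pi> v V] unfolding pg_aut_def bij_def by auto
  then show ?thesis by (cases x) auto
qed

text \<open>The support is the single atom \<open>w\<close>: an automorphism fixing \<open>w\<close>
  preserves \<open>Phi\<close>, hence the function.\<close>

lemma pairing_in_FpX:
  assumes "w \<in> Vs"
  shows "pairing w \<in> FpX p V Vs add smul Phi ((\<lambda>v. [v]) ` V)"
proof -
  have "pairing w \<circ> map \<pi> = pairing w" if \<pi>: "pg_aut p V Vs add smul Phi \<pi>" "\<pi> w = w" for \<pi>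
  proof
    fix x
    show "(pairing w \<circ> map \<pi>) x = pairing w x"
    proof (cases "x \<in> (\<lambda>v. [v]) ` V")
      case True
      then obtain v where v: "v \<in> V" "x = [v]" by blast
      have "\<pi> v \<in> V" using v \<pi> unfolding pg_aut_def by blast
      moreover have "Phi (\<pi> v) w = Phi v w" using v \<pi> assms unfolding pg_aut_def by metis
      ultimately show ?thesis using v by (simp add: pairing_single)
    next
      case False
      then show ?thesis using map_aut_single_iff[OF \<pi>(1), of x] by (simp add: pairing_outside)
    qed
  qed
  then have "fsupp_fun p V Vs add smul Phi (pairing w)"
    unfolding fsupp_fun_def using assms by (intro exI[of _ "{w}"]) auto
  moreover have "pairing w x < p" for x
    using Phi_less assms V.p_pos unfolding pairing_def by auto
  ultimately show ?thesis unfolding FpX_def using pairing_outside by blast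
qed

text \<open>Used in two cases: \<open>Phi b w = 1\<close> gives translation by
  \<open>pairing a\<close>, and \<open>Phi b w = 0\<close> gives invariance.\<close>

lemma pairing_transvection:
  assumes "b \<in> V" "a \<in> Vs" "Phi b a = 0" "w \<in> Vs"
  shows "pairing w \<circ> map (transvection b a) = (\<lambda>x. (pairing w x + Phi b w * pairing a x) mod p)"
proof
  fix x
  let ?t = "transvection b a"
  have t: "pg_aut p V Vs add smul Phi ?t" using transvection_aut assms by blast
  show "(pairing w \<circ> map ?t) x = (pairing w x + Phi b w * pairing a x) mod p"
  proof (cases "x \<in> (\<lambda>v. [v]) ` V")
    case True
    then obtain v where v: "v \<in> V" "x = [v]" by blast
    have tv: "?t v \<in> V" using v t unfolding pg_aut_def by blast
    have "Phi (?t v) w = (Phi v w + Phi v a * Phi b w) mod p"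
      using v assms Phi_less V.smul_closed
      by (simp add: transvection_V Phi_add_left Phi_smul_left mod_simps)
    then show ?thesis using v tv by (simp add: pairing_single mult.commute)
  next
    case False
    then show ?thesis using map_aut_single_iff[OF t, of x] by (simp add: pairing_outside)
  qed
qed

lemma transvection_fixes:
  assumes "b \<in> V" "a \<in> Vs" "s \<in> V \<union> Vs"
    and "s \<in> V \<Longrightarrow> Phi s a = 0" and "s \<in> Vs \<Longrightarrow> Phi b s = 0"
  shows "transvection b a s = s"
  using assms V.smul_zero V.add_zero Vs.smul_zero Vs.add_zero
  by (auto simp: transvection_V transvection_Vs)

lemma no_basis: "\<not> has_zfa_basis p V Vs add smul Phi ((\<lambda>v. [v]) ` V)"
proof
  let ?X = "(\<lambda>v. [v]) ` V"
  assume "has_zfa_basis p V Vs add smul Phi ?X"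
  then obtain B where supp: "fsupp_fun_set p V Vs add smul Phi B"
    and indep: "independent_mod p B"
    and span: "\<forall>f\<in>FpX p V Vs add smul Phi ?X. \<exists>F c. finite F \<and> F \<subseteq> B \<and>
        f = (\<lambda>x. (\<Sum>g\<in>F. c g * g x) mod p)"
    unfolding has_zfa_basis_def
    by (elim exE conjE) (rule that, assumption, subst independent_mod_def)
  obtain S where S: "finite S" "S \<subseteq> V \<union> Vs"
    and supports: "\<forall>\<pi>\<in>Collect (pg_aut p V Vs add smul Phi). (\<forall>s\<in>S. \<pi> s = s) \<longrightarrow>
      (\<lambda>f. f \<circ> map \<pi>) ` B = B"
    using supp unfolding fsupp_fun_set_def by (elim exE conjE) (rule that)
  have B_invariant: "(\<lambda>f. f \<circ> map \<pi>) ` B = B"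
    if "pg_aut p V Vs add smul Phi \<pi>" "\<forall>s\<in>S. \<pi> s = s" for \<pi>
    by (rule supports[rule_format]) (use that in auto)
  \<comment> \<open>Candidates for \<open>b\<close>: if the covectors in \<open>S\<close> annihilate
    \<open>b\<close>, every transvection along \<open>b\<close> fixes them.\<close>
  define Z where "Z = {u \<in> V. \<forall>\<phi>\<in>(\<lambda>w u. Phi u w) ` (S \<inter> Vs). \<phi> u = 0}"
  have "infinite Z" unfolding Z_def
    by (rule V.infinite_common_zeros[OF infinite_V]) (use S functional_left in auto)
  then have "Z - {zV} \<noteq> {}" by (intro infinite_imp_nonempty) simp
  then obtain b where "b \<in> Z" "b \<noteq> zV" by blast
  then have b: "b \<in> V" "b \<noteq> zV" "\<And>s. s \<in> S \<Longrightarrow> s \<in> Vs \<Longrightarrow> Phi b s = 0"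
    unfolding Z_def by auto
  obtain w where w: "w \<in> Vs" "Phi b w = 1"
    using extension_Vs[OF V.lin_indep_list_single[OF b(1,2)], of "[1]"] V.p_gt_1 by auto
  \<comment> \<open>Annihilating \<open>b\<close> makes the transvection an automorphism and fixes
    the functions \<open>pairing a'\<close> for \<open>a'\<close> in \<open>N\<close>; annihilating
    the vectors in \<open>S\<close> makes it fix them.\<close>
  define N where "N = {a \<in> Vs. \<forall>\<phi>\<in>Phi ` insert b (S \<inter> V). \<phi> a = 0}"
  have "infinite N" unfolding N_def
    by (rule Vs.infinite_common_zeros[OF infinite_Vs]) (use S b functional_right in auto)
  have N: "a \<in> Vs" "Phi b a = 0" "\<And>s. s \<in> S \<Longrightarrow> s \<in> V \<Longrightarrow> Phi s a = 0" if "a \<in> N" for a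
    using that unfolding N_def by auto
  have aut: "pg_aut p V Vs add smul Phi (transvection b a)" if "a \<in> N" for a
    using transvection_aut b N that by blast
  have coords: "\<exists>k. coords p B k (pairing u)" if "u \<in> Vs" for u
    using bspec[OF span pairing_in_FpX[OF that]]
    by (elim exE conjE) (rule coords_exists[OF V.p_pos])
  obtain k where k: "coords p B k (pairing w)" using coords w by blast
  obtain l where l: "\<And>a. a \<in> N \<Longrightarrow> coords p B (l a) (pairing a)" using coords N(1) by metis
  have pairing_mod: "pairing u x mod p = pairing u x" if "u \<in> Vs" for u x
    using pairing_in_FpX[OF that] unfolding FpX_def by simp
  have "finite N"
  proof (rule finite_translations_of_basis[where \<sigma> = "\<lambda>a. map (transvection b a)",
        OF V.p_pos indep _ _ k l])
    fix a assume a: "a \<in> N"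
    show "bij (map (transvection b a))"
      using bij_lists[OF aut_bij[OF aut[OF a]]] by simp
    have "\<forall>s\<in>S. transvection b a s = s"
      using transvection_fixes b N[OF a] S(2) by blast
    then show "(\<lambda>g. g \<circ> map (transvection b a)) ` B = B"
      by (rule B_invariant[OF aut[OF a]])
    show "pairing w \<circ> map (transvection b a) = (\<lambda>x. (pairing w x + pairing a x) mod p)"
      using pairing_transvection b N[OF a] w by simp
    show "pairing a' \<circ> map (transvection b a) = pairing a'" if "a' \<in> N" for a'
      using pairing_transvection b N[OF a] N[OF that] pairing_mod by simp
  next
    \<comment> \<open>Distinct \<open>a\<close> give distinct translates because \<open>Phi\<close>
      separates covectors and its values are already reduced modulo \<open>p\<close>.\<close>
    show "inj_on (\<lambda>a x. (pairing w x + pairing a x) mod p) N"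
    proof (rule inj_onI)
      fix a a' assume a: "a \<in> N" "a' \<in> N"
        and eq: "(\<lambda>x. (pairing w x + pairing a x) mod p) = (\<lambda>x. (pairing w x + pairing a' x) mod p)"
      show "a = a'"
      proof (rule covector_eqI)
        fix u assume u: "u \<in> V"
        have "[Phi u w + Phi u a = Phi u w + Phi u a'] (mod p)"
          using fun_cong[OF eq, of "[u]"] u by (simp add: pairing_single cong_def)
        then have "[Phi u a = Phi u a'] (mod p)" by (simp add: cong_add_lcancel_nat)
        then show "Phi u a = Phi u a'"
          using Phi_less u N(1) a by (simp add: cong_def)
      qed (use N a in auto)
    qed
  qed
  then show False using \<open>infinite N\<close> by blast
qed

end

theorem mainTheorem14:
  fixes p :: nat and V Vs :: "'a set" and zV zVs :: 'a
    and add :: "'a \<Rightarrow> 'a \<Rightarrow> 'a" and smul :: "'a \<Rightarrow> nat \<Rightarrow> 'a" and Phi :: "'a \<Rightarrow> 'a \<Rightarrow> nat"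
  assumes "prime p"
    and "polar_geometry p V Vs zV zVs add smul Phi"
  shows "\<exists>X. definable_tuples p V Vs add smul Phi X \<and>
             \<not> has_zfa_basis p V Vs add smul Phi X"
proof -
  interpret polar p V Vs zV zVs add smul Phi
    using assms by unfold_locales
  show ?thesis using definable_vectors no_basis by blast
qed

end
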